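(* For all integers $m,n,m',n'\ge 0$, $$A_{\xi}H_{m,n,m',n'}=m\,H_{m-1,n,m',n'},\qquad A_{\overline{\xi}}H_{m,n,m',n'}=n\,H_{m,n-1,m',n'},$$ $$A_{\xi^*}H_{m,n,m',n'}=m'\,H_{m,n,m'-1,n'},\qquad A_{\widetilde{\xi}}H_{m,n,m',n'}=n'\,H_{m,n,m',n'-1},$$ where a right-hand side with coefficient $0$ is understood to be $0$.
   Context: For integers $m,n\ge 0$ and $\zeta\in\mathbb{C}$, $H_{m,n}(\zeta,\overline{\zeta})=(-1)^{m+n}e^{|\zeta|^2}\frac{\partial^{m+n}}{\partial\overline{\zeta}^{m}\partial\zeta^{n}}\left(e^{-|\zeta|^2}\right)$ (Wirtinger derivatives). For $(z,w)\in\mathbb{C}^2$ set $\xi=z+iw$, $\overline{\xi}=\overline{z}-i\overline{w}$, $\xi^*=\overline{z}+i\overline{w}$, $\widetilde{\xi}=z-iw$, and define $H_{m,n,m',n'}(z,w)=H_{m,n}(\xi,\overline{\xi})\,H_{m',n'}(\xi^*,\widetilde{\xi})$. The first order differential operators are $A_{\xi}=\frac12\left(\frac{\partial}{\partial z}-i\frac{\partial}{\partial w}\right)$, $A_{\xi^*}=\frac12\left(\frac{\partial}{\partial\overline{z}}-i\frac{\partial}{\partial\overline{w}}\right)$, $A_{\overline{\xi}}=\frac12\left(\frac{\partial}{\partial\overline{z}}+i\frac{\partial}{\partial\overline{w}}\right)$, $A_{\widetilde{\xi}}=\frac12\left(\frac{\partial}{\partial z}+i\frac{\partial}{\partial w}\right)$.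 *)

theory Defs
  imports "HOL-Analysis.Analysis"
begin

definition partial_re :: "(complex \<Rightarrow> complex) \<Rightarrow> complex \<Rightarrow> complex" where
  "partial_re f z = vector_derivative (\<lambda>t::real. f (z + of_real t)) (at 0)"

definition partial_im :: "(complex \<Rightarrow> complex) \<Rightarrow> complex \<Rightarrow> complex" where
  "partial_im f z = vector_derivative (\<lambda>t::real. f (z + \<i> * of_real t)) (at 0)"

text \<open>The Wirtinger derivatives \<open>\<partial>/\<partial>z\<close> and \<open>\<partial>/\<partial>z\<bar>\<close>. As with \<^const>\<open>vector_derivative\<close>, the
  value is unspecified where a real partial derivative does not exist.\<close>

definition wirtinger :: "(complex \<Rightarrow> complex) \<Rightarrow> complex \<Rightarrow> complex" where
  "wirtinger f z = (partial_re f z - \<i> * partial_im f z) / 2"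

definition wirtinger_bar :: "(complex \<Rightarrow> complex) \<Rightarrow> complex \<Rightarrow> complex" where
  "wirtinger_bar f z = (partial_re f z + \<i> * partial_im f z) / 2"

text \<open>\<open>chermite m n \<zeta>\<close> is \<open>H\<^sub>m\<^sub>,\<^sub>n(\<zeta>, \<zeta>\<bar>)\<close>: the second argument of the usual notation is the
  conjugate of the first, so it is not an independent variable.\<close>

definition chermite :: "nat \<Rightarrow> nat \<Rightarrow> complex \<Rightarrow> complex" where
  "chermite m n \<zeta> =
     (-1) ^ (m + n) * exp (of_real ((cmod \<zeta>)\<^sup>2)) *
     (wirtinger_bar ^^ m) ((wirtinger ^^ n) (\<lambda>u. exp (- of_real ((cmod u)\<^sup>2)))) \<zeta>"

definition xi :: "complex \<Rightarrow> complex \<Rightarrow> complex" where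
  "xi z w = z + \<i> * w"

definition xi_bar :: "complex \<Rightarrow> complex \<Rightarrow> complex" where
  "xi_bar z w = cnj z - \<i> * cnj w"

definition xi_star :: "complex \<Rightarrow> complex \<Rightarrow> complex" where
  "xi_star z w = cnj z + \<i> * cnj w"

definition xi_tilde :: "complex \<Rightarrow> complex \<Rightarrow> complex" where
  "xi_tilde z w = z - \<i> * w"

text \<open>\<open>(xi, xi_bar)\<close> and \<open>(xi_star, xi_tilde)\<close> are pairs of conjugates, which makes
  \<open>H\<^sub>m\<^sub>,\<^sub>n(\<xi>, \<xi>\<bar>)\<close> and \<open>H\<^sub>m\<^sub>,\<^sub>n(\<xi>*, \<xi>~)\<close> instances of \<open>chermite\<close>.\<close>

lemma cnj_xi: "cnj (xi z w) = xi_bar z w"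
  by (simp add: xi_def xi_bar_def)

lemma cnj_xi_star: "cnj (xi_star z w) = xi_tilde z w"
  by (simp add: xi_star_def xi_tilde_def)

definition chermite4 :: "nat \<Rightarrow> nat \<Rightarrow> nat \<Rightarrow> nat \<Rightarrow> complex \<times> complex \<Rightarrow> complex" where
  "chermite4 m n m' n' = (\<lambda>(z, w). chermite m n (xi z w) * chermite m' n' (xi_star z w))"

definition d_z :: "(complex \<times> complex \<Rightarrow> complex) \<Rightarrow> complex \<times> complex \<Rightarrow> complex" where
  "d_z F = (\<lambda>(z, w). wirtinger (\<lambda>u. F (u, w)) z)"

definition d_w :: "(complex \<times> complex \<Rightarrow> complex) \<Rightarrow> complex \<times> complex \<Rightarrow> complex" where
  "d_w F = (\<lambda>(z, w). wirtinger (\<lambda>v. F (z, v)) w)"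

definition d_z_bar :: "(complex \<times> complex \<Rightarrow> complex) \<Rightarrow> complex \<times> complex \<Rightarrow> complex" where
  "d_z_bar F = (\<lambda>(z, w). wirtinger_bar (\<lambda>u. F (u, w)) z)"

definition d_w_bar :: "(complex \<times> complex \<Rightarrow> complex) \<Rightarrow> complex \<times> complex \<Rightarrow> complex" where
  "d_w_bar F = (\<lambda>(z, w). wirtinger_bar (\<lambda>v. F (z, v)) w)"

definition A_xi :: "(complex \<times> complex \<Rightarrow> complex) \<Rightarrow> complex \<times> complex \<Rightarrow> complex" where
  "A_xi F p = (d_z F p - \<i> * d_w F p) / 2"

definition A_xi_star :: "(complex \<times> complex \<Rightarrow> complex) \<Rightarrow> complex \<times> complex \<Rightarrow> complex" where
  "A_xi_star F p = (d_z_bar F p - \<i> * d_w_bar F p) / 2"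

definition A_xi_bar :: "(complex \<times> complex \<Rightarrow> complex) \<Rightarrow> complex \<times> complex \<Rightarrow> complex" where
  "A_xi_bar F p = (d_z_bar F p + \<i> * d_w_bar F p) / 2"

definition A_xi_tilde :: "(complex \<times> complex \<Rightarrow> complex) \<Rightarrow> complex \<times> complex \<Rightarrow> complex" where
  "A_xi_tilde F p = (d_z F p + \<i> * d_w F p) / 2"

end

theory Submission
  imports Defs
begin

text \<open>Everything rests on real Frechet derivatives of the shape \<open>h \<mapsto> a h + b h\<bar>\<close>, whose
  coefficients are the two Wirtinger derivatives. The recursion
  \<open>P\<^sub>m\<^sub>+\<^sub>1\<^sub>,\<^sub>n = \<zeta> P\<^sub>m\<^sub>,\<^sub>n - n P\<^sub>m\<^sub>,\<^sub>n\<^sub>-\<^sub>1\<close>, \<open>P\<^sub>0\<^sub>,\<^sub>n = \<zeta>\<bar>\<^sup>n\<close> yields by induction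
  \<open>\<partial>P\<^sub>m\<^sub>,\<^sub>n = m P\<^sub>m\<^sub>-\<^sub>1\<^sub>,\<^sub>n\<close> and \<open>\<partial>\<bar>P\<^sub>m\<^sub>,\<^sub>n = n P\<^sub>m\<^sub>,\<^sub>n\<^sub>-\<^sub>1\<close>; the latter shows that the
  Rodrigues formula for \<open>H\<^sub>m\<^sub>,\<^sub>n\<close> obeys the same recursion, so \<open>H\<^sub>m\<^sub>,\<^sub>n = P\<^sub>m\<^sub>,\<^sub>n\<close>. The
  four operators are dual to the coordinates \<open>\<xi>, \<xi>\<bar>, \<xi>*, \<xi>~\<close>, and the chain rule concludes.\<close>

text \<open>A total derivative is required, not just the two partial ones, so that the product and
  chain rules apply.\<close>

definition has_wirtinger ::
    "(complex \<Rightarrow> complex) \<Rightarrow> complex \<Rightarrow> complex \<Rightarrow> complex \<Rightarrow> bool" where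
  "has_wirtinger f a b z \<longleftrightarrow> (f has_derivative (\<lambda>h. a * h + b * cnj h)) (at z)"

text \<open>Evaluating \<open>D\<close> at \<open>c = 1\<close> and \<open>c = \<i>\<close> gives
  \<open>partial_re\<close> and \<open>partial_im\<close>.\<close>

lemma has_derivative_along_line:
  fixes f :: "complex \<Rightarrow> complex"
  assumes "(f has_derivative D) (at z)"
  shows "vector_derivative (\<lambda>t::real. f (z + c * of_real t)) (at 0) = D c"
proof -
  have line: "((\<lambda>t::real. z + c * of_real t) has_vector_derivative c) (at 0)"
    by (auto intro!: derivative_eq_intros simp: has_vector_derivative_def scaleR_conv_of_real)
  have "(f has_derivative D) (at (z + c * of_real 0) within range (\<lambda>t::real. z + c * of_real t))"
    using assms by (simp add: has_derivative_at_withinI)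
  from vector_derivative_diff_chain_within[OF line this]
  show ?thesis by (simp add: o_def vector_derivative_at)
qed

lemma has_wirtinger_imp:
  assumes "has_wirtinger f a b z"
  shows "wirtinger f z = a" "wirtinger_bar f z = b"
proof -
  note line = has_derivative_along_line[OF assms[unfolded has_wirtinger_def]]
  have "partial_re f z = a + b" "partial_im f z = \<i> * (a - b)"
    using line[of 1] line[of \<i>] by (simp_all add: partial_re_def partial_im_def algebra_simps)
  then show "wirtinger f z = a" "wirtinger_bar f z = b"
    by (simp_all add: wirtinger_def wirtinger_bar_def flip: mult.assoc)
qed

lemma has_wirtinger_mult:
  assumes "has_wirtinger f a b z" "has_wirtinger g c d z"
  shows "has_wirtinger (\<lambda>u. f u * g u) (a * g z + f z * c) (b * g z + f z * d) z"
  using assms unfolding has_wirtinger_def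
  by (auto intro!: derivative_eq_intros simp: algebra_simps)

lemma has_wirtinger_diff:
  assumes "has_wirtinger f a b z" "has_wirtinger g c d z"
  shows "has_wirtinger (\<lambda>u. f u - g u) (a - c) (b - d) z"
  using assms unfolding has_wirtinger_def
  by (auto intro!: derivative_eq_intros simp: algebra_simps)

lemma has_wirtinger_cmult:
  assumes "has_wirtinger f a b z"
  shows "has_wirtinger (\<lambda>u. c * f u) (c * a) (c * b) z"
  using assms unfolding has_wirtinger_def
  by (auto intro!: derivative_eq_intros simp: algebra_simps)

lemma has_wirtinger_ident: "has_wirtinger (\<lambda>u. u) 1 0 z"
  by (simp add: has_wirtinger_def)

lemma has_wirtinger_cnj_power:
  "has_wirtinger (\<lambda>u. cnj u ^ n) 0 (of_nat n * cnj z ^ (n - 1)) z"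
  unfolding has_wirtinger_def
  by (auto intro!: derivative_eq_intros simp: algebra_simps)

definition gaussian :: "complex \<Rightarrow> complex" where
  "gaussian u = exp (- of_real ((cmod u)\<^sup>2))"

lemma has_wirtinger_gaussian:
  "has_wirtinger gaussian (- cnj z * gaussian z) (- z * gaussian z) z"
proof -
  \<comment> \<open>Writing the squared modulus as \<open>u * cnj u\<close> makes the exponent
    differentiable by the product rule.\<close>
  have eq: "gaussian = (\<lambda>u. exp (- (u * cnj u)))"
    by (rule ext) (simp only: gaussian_def complex_norm_square)
  have "((\<lambda>u. - (u * cnj u)) has_derivative (\<lambda>h. - (h * cnj z + z * cnj h))) (at z)"
    by (auto intro!: derivative_eq_intros simp: algebra_simps)
  note has_derivative_compose[OF this DERIV_exp[unfolded has_field_derivative_def]]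
  then show ?thesis
    unfolding has_wirtinger_def eq
    by (rule has_derivative_eq_rhs) (simp add: algebra_simps)
qed

text \<open>At \<open>n = 0\<close> the truncated index \<open>n - 1\<close> is harmless, as its coefficient vanishes.\<close>

primrec hpoly :: "nat \<Rightarrow> nat \<Rightarrow> complex \<Rightarrow> complex" where
  "hpoly 0 n z = cnj z ^ n"
| "hpoly (Suc m) n z = z * hpoly m n z - of_nat n * hpoly m (n - 1) z"

lemma has_wirtinger_hpoly:
  "has_wirtinger (hpoly m n) (of_nat m * hpoly (m - 1) n z) (of_nat n * hpoly m (n - 1) z) z"
proof (induction m arbitrary: n)
  case 0
  have "hpoly 0 n = (\<lambda>u. cnj u ^ n)" by (simp add: fun_eq_iff)
  then show ?case using has_wirtinger_cnj_power by simp
next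
  case (Suc m)
  have eq: "hpoly (Suc m) n = (\<lambda>u. u * hpoly m n u - of_nat n * hpoly m (n - 1) u)"
    by (simp add: fun_eq_iff)
  have "has_wirtinger (hpoly (Suc m) n)
      (1 * hpoly m n z + z * (of_nat m * hpoly (m - 1) n z)
        - of_nat n * (of_nat m * hpoly (m - 1) (n - 1) z))
      (0 * hpoly m n z + z * (of_nat n * hpoly m (n - 1) z)
        - of_nat n * (of_nat (n - 1) * hpoly m (n - 1 - 1) z)) z"
    unfolding eq
    by (intro has_wirtinger_diff has_wirtinger_mult has_wirtinger_cmult has_wirtinger_ident Suc.IH)
  \<comment> \<open>For \<open>m = 0\<close> the terms with factor \<open>of_nat m\<close> vanish;
    otherwise the recursion folds them into \<open>of_nat m * hpoly m n z\<close>.\<close>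
  moreover have "1 * hpoly m n z + z * (of_nat m * hpoly (m - 1) n z)
        - of_nat n * (of_nat m * hpoly (m - 1) (n - 1) z) = of_nat (Suc m) * hpoly m n z"
    by (cases m) (simp_all add: algebra_simps)
  moreover have "0 * hpoly m n z + z * (of_nat n * hpoly m (n - 1) z)
        - of_nat n * (of_nat (n - 1) * hpoly m (n - 1 - 1) z)
      = of_nat n * hpoly (Suc m) (n - 1) z"
    by (simp add: algebra_simps)
  ultimately show ?case by (simp only: diff_Suc_1)
qed

text \<open>\<open>hpoly 0 n\<close> is antiholomorphic, so each derivative hits only the Gaussian
  and contributes \<open>- cnj u\<close>.\<close>

lemma wirtinger_power_gaussian:
  "(wirtinger ^^ n) gaussian = (\<lambda>u. (-1) ^ n * (hpoly 0 n u * gaussian u))"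
proof (induction n)
  case (Suc n)
  show ?case
  proof
    fix z
    note has_wirtinger_cmult[OF has_wirtinger_mult
        [OF has_wirtinger_hpoly[of 0 n z] has_wirtinger_gaussian], of "(-1) ^ n"]
    from has_wirtinger_imp(1)[OF this]
    show "(wirtinger ^^ Suc n) gaussian z = (-1) ^ Suc n * (hpoly 0 (Suc n) z * gaussian z)"
      by (simp add: Suc.IH)
  qed
qed simp

text \<open>The product rule gives the factor
  \<open>of_nat n * hpoly m (n - 1) u - u * hpoly m n u\<close>, which is minus the recursion for
  \<open>hpoly (Suc m) n u\<close>.\<close>

lemma wirtinger_bar_power_gaussian:
  "(wirtinger_bar ^^ m) ((wirtinger ^^ n) gaussian)
     = (\<lambda>u. (-1) ^ (m + n) * (hpoly m n u * gaussian u))"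
proof (induction m)
  case 0
  then show ?case by (simp add: wirtinger_power_gaussian)
next
  case (Suc m)
  show ?case
  proof
    fix z
    note has_wirtinger_cmult[OF has_wirtinger_mult
        [OF has_wirtinger_hpoly[of m n z] has_wirtinger_gaussian], of "(-1) ^ (m + n)"]
    from has_wirtinger_imp(2)[OF this]
    show "(wirtinger_bar ^^ Suc m) ((wirtinger ^^ n) gaussian) z
        = (-1) ^ (Suc m + n) * (hpoly (Suc m) n z * gaussian z)"
      by (simp add: Suc.IH algebra_simps)
  qed
qed

lemma chermite_eq_hpoly: "chermite m n = hpoly m n"
proof
  fix z
  have "chermite m n z = (-1) ^ (m + n) * exp (of_real ((cmod z)\<^sup>2))
      * ((-1) ^ (m + n) * (hpoly m n z * gaussian z))"
    using fun_cong[OF wirtinger_bar_power_gaussian, of m n z]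
    by (simp add: chermite_def gaussian_def[abs_def])
  also have "\<dots> = ((-1) ^ (m + n) * (-1) ^ (m + n))
      * (exp (of_real ((cmod z)\<^sup>2)) * gaussian z) * hpoly m n z"
    by (simp only: ac_simps)
  also have "\<dots> = hpoly m n z"
    by (simp add: gaussian_def flip: exp_add power_mult_distrib)
  finally show "chermite m n z = hpoly m n z" .
qed

lemma has_derivative_chermite:
  "(chermite m n has_derivative
     (\<lambda>h. of_nat m * chermite (m - 1) n z * h + of_nat n * chermite m (n - 1) z * cnj h)) (at z)"
  using has_wirtinger_hpoly[of m n z] by (simp add: chermite_eq_hpoly has_wirtinger_def)

text \<open>\<open>xi\<close> is holomorphic and \<open>xi_star\<close> antiholomorphic in each
  variable, so the \<open>m\<close> and \<open>n'\<close> terms go with the holomorphic derivative,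
  the \<open>n\<close> and \<open>m'\<close> terms with the other.\<close>

lemma has_wirtinger_chermite4:
  shows "has_wirtinger (\<lambda>u. chermite4 m n m' n' (u, w))
      (of_nat m * chermite4 (m - 1) n m' n' (z, w) + of_nat n' * chermite4 m n m' (n' - 1) (z, w))
      (of_nat n * chermite4 m (n - 1) m' n' (z, w) + of_nat m' * chermite4 m n (m' - 1) n' (z, w)) z"
      (is ?Z)
    and "has_wirtinger (\<lambda>v. chermite4 m n m' n' (z, v))
      (\<i> * (of_nat m * chermite4 (m - 1) n m' n' (z, w)
        - of_nat n' * chermite4 m n m' (n' - 1) (z, w)))
      (\<i> * (of_nat m' * chermite4 m n (m' - 1) n' (z, w)
        - of_nat n * chermite4 m (n - 1) m' n' (z, w))) w"
      (is ?W)
proof -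
  have "((\<lambda>u. xi u w) has_derivative (\<lambda>h. h)) (at z)"
    "((\<lambda>u. xi_star u w) has_derivative cnj) (at z)"
    unfolding xi_def xi_star_def by (auto intro!: derivative_eq_intros)
  note dz = has_derivative_mult[OF has_derivative_compose[OF this(1) has_derivative_chermite]
      has_derivative_compose[OF this(2) has_derivative_chermite]]
  show ?Z
    unfolding has_wirtinger_def chermite4_def prod.case
    by (rule has_derivative_eq_rhs[OF dz]) (simp add: algebra_simps)
  have "((\<lambda>v. xi z v) has_derivative (\<lambda>h. \<i> * h)) (at w)"
    "((\<lambda>v. xi_star z v) has_derivative (\<lambda>h. \<i> * cnj h)) (at w)"
    unfolding xi_def xi_star_def by (auto intro!: derivative_eq_intros)
  note dw = has_derivative_mult[OF has_derivative_compose[OF this(1) has_derivative_chermite]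
      has_derivative_compose[OF this(2) has_derivative_chermite]]
  show ?W
    unfolding has_wirtinger_def chermite4_def prod.case
    by (rule has_derivative_eq_rhs[OF dw]) (simp add: algebra_simps)
qed

theorem proposition3p8:
  fixes m n m' n' :: nat
  shows "A_xi (chermite4 m n m' n') = (\<lambda>p. of_nat m * chermite4 (m - 1) n m' n' p)
       \<and> A_xi_bar (chermite4 m n m' n') = (\<lambda>p. of_nat n * chermite4 m (n - 1) m' n' p)
       \<and> A_xi_star (chermite4 m n m' n') = (\<lambda>p. of_nat m' * chermite4 m n (m' - 1) n' p)
       \<and> A_xi_tilde (chermite4 m n m' n') = (\<lambda>p. of_nat n' * chermite4 m n m' (n' - 1) p)"
  \<comment> \<open>Multiplying the \<open>w\<close>-derivatives by \<open>\<i>\<close> or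
    \<open>- \<i>\<close> cancels one of the two terms and doubles the other, which absorbs the
    factor 1/2.\<close>
  by (simp add: fun_eq_iff A_xi_def A_xi_bar_def A_xi_star_def A_xi_tilde_def
      d_z_def d_w_def d_z_bar_def d_w_bar_def
      has_wirtinger_imp[OF has_wirtinger_chermite4(1)]
      has_wirtinger_imp[OF has_wirtinger_chermite4(2)] algebra_simps)

end
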